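(* Assume $\kappa$ is an uncountable regular cardinal. Every continuous image of a $\kappa$-Corson compact space is $\kappa$-Corson. That is, if $K$ is a $\kappa$-Corson compact space, $L$ is a compact Hausdorff space, and there is a continuous surjection $K \to L$, then $L$ is $\kappa$-Corson.
   Context: For a set $S$, $\Sigma_\kappa(S) = \{x \in [0,1]^S : |\mathrm{supp}(x)| < \kappa\}$ with the pointwise (product) topology, where $\mathrm{supp}(x) = \{\alpha \in S : x(\alpha) \neq 0\}$. A compact space is $\kappa$-Corson if it is topologically embeddable in $\Sigma_\kappa(S)$ for some set $S$. Compact spaces are Hausdorff. *)

theory Defs
  imports "HOL-Analysis.Analysis"
begin

unbundle cardinal_syntax

text \<open>
  An element of \<open>[0,1]\<^sup>S\<close> is a function extensional on \<open>S\<close>, as usual for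
  \<^const>\<open>product_topology\<close>, so only its values on \<open>S\<close> count for the support.
\<close>

definition supp :: "'s set \<Rightarrow> ('s \<Rightarrow> real) \<Rightarrow> 's set" where
  "supp S x = {\<alpha> \<in> S. x \<alpha> \<noteq> 0}"

definition Sigma_space :: "'k rel \<Rightarrow> 's set \<Rightarrow> ('s \<Rightarrow> real) topology" where
  "Sigma_space \<kappa> S =
     subtopology (product_topology (\<lambda>_. top_of_set {0..1::real}) S) {x. |supp S x| <o \<kappa>}"

text \<open>
  HOL cannot quantify over the type of the index set, so \<open>S\<close> ranges over the sets of functions
  \<open>'a \<Rightarrow> real\<close>. This loses no generality: the lemma \<open>kappa_CorsonI\<close> below
  shows that an embedding with an index set of any type whatsoever is enough
  (identify coordinates that induce the same function on the space).
\<close>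

definition kappa_Corson :: "'k rel \<Rightarrow> 'a topology \<Rightarrow> bool" where
  "kappa_Corson \<kappa> X \<longleftrightarrow> compact_space X \<and> Hausdorff_space X \<and>
     (\<exists>(S :: ('a \<Rightarrow> real) set) f. embedding_map X (Sigma_space \<kappa> S) f)"

lemma kappa_CorsonI:
  fixes S :: "'s set" and X :: "'a topology" and \<kappa> :: "'k rel"
  assumes X: "compact_space X" "Hausdorff_space X"
    and f: "embedding_map X (Sigma_space \<kappa> S) f"
  shows "kappa_Corson \<kappa> X"
proof -
  define c where "c = (\<lambda>\<alpha>. restrict (\<lambda>x. f x \<alpha>) (topspace X))"
  define T where "T = c ` S"
  define g where "g = (\<lambda>x. restrict (\<lambda>t. t x) T)"
  let ?I = "top_of_set {0..1::real}"
  have cf: "continuous_map X (Sigma_space \<kappa> S) f"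
    using f unfolding embedding_map_def
    by (meson continuous_map_in_subtopology homeomorphic_imp_continuous_map)
  then have cf': "continuous_map X (product_topology (\<lambda>_. ?I) S) f"
    and sf: "\<And>x. x \<in> topspace X \<Longrightarrow> |supp S (f x)| <o \<kappa>"
    by (auto simp: Sigma_space_def continuous_map_in_subtopology)
  have inj: "inj_on f (topspace X)"
    using f by (simp add: embedding_map_def homeomorphic_map_def)
  have cT: "continuous_map X ?I t" if t: "t \<in> T" for t
  proof -
    obtain \<alpha> where \<alpha>: "\<alpha> \<in> S" "t = c \<alpha>" using t T_def by auto
    have "continuous_map X ?I (\<lambda>x. f x \<alpha>)"
      using cf' \<alpha> by (simp add: continuous_map_componentwise)
    then show ?thesis
      by (rule continuous_map_eq) (simp add: \<alpha> c_def)
  qed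
  have cg: "continuous_map X (product_topology (\<lambda>_. ?I) T) g"
    unfolding continuous_map_componentwise
    using cT by (auto simp: g_def)
  have sg: "|supp T (g x)| <o \<kappa>" if x: "x \<in> topspace X" for x
  proof -
    have "supp T (g x) \<subseteq> c ` supp S (f x)"
      using x by (auto simp: supp_def g_def T_def c_def)
    then have "|supp T (g x)| \<le>o |supp S (f x)|"
      by (meson card_of_image card_of_mono1 ordLeq_transitive)
    then show ?thesis using sf[OF x] ordLeq_ordLess_trans by blast
  qed
  have injg: "inj_on g (topspace X)"
  proof (rule inj_onI)
    fix x y assume xy: "x \<in> topspace X" "y \<in> topspace X" "g x = g y"
    have "f x \<alpha> = f y \<alpha>" if "\<alpha> \<in> S" for \<alpha>
    proof -
      have "c \<alpha> \<in> T" using that by (simp add: T_def)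
      then have "c \<alpha> x = c \<alpha> y" using fun_cong[OF xy(3), of "c \<alpha>"] by (simp add: g_def)
      then show ?thesis using xy by (simp add: c_def)
    qed
    moreover have "f x \<in> extensional S" "f y \<in> extensional S"
      using cf' xy by (auto simp: continuous_map_componentwise)
    ultimately have "f x = f y" by (meson extensionalityI)
    then show "x = y" using inj xy by (simp add: inj_on_def)
  qed
  have "continuous_map X (Sigma_space \<kappa> T) g"
    using cg sg by (auto simp: Sigma_space_def continuous_map_in_subtopology)
  moreover have "Hausdorff_space (Sigma_space \<kappa> T)"
    by (simp add: Sigma_space_def Hausdorff_space_subtopology Hausdorff_space_product_topology)
  ultimately have "embedding_map X (Sigma_space \<kappa> T) g"
    using X injg by (simp add: continuous_imp_closed_map injective_closed_imp_embedding_map)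
  then show ?thesis using X by (auto simp: kappa_Corson_def)
qed

end

theory Submission
  imports Defs "HOL-Algebra.Free_Abelian_Groups"
begin

text \<open>
  View \<open>K\<close> as a compact set of functions with supports smaller than \<open>\<kappa>\<close>, and let \<open>E\<close> be the
  closed relation \<open>f x = f y\<close> on \<open>K\<close>. Call a set \<open>A\<close> of coordinates saturated if every rational
  box over finitely many coordinates in \<open>A\<close> that meets \<open>E\<close> meets it in a pair supported in \<open>A\<close>
  (a pair chosen once and for all for each box). By compactness, restricting to a saturated \<open>A\<close>
  maps \<open>K\<close> to \<open>K\<close> and \<open>E\<close> to \<open>E\<close>, so it induces a retraction of \<open>L\<close>. Saturated sets are
  plentiful: saturating a set of size at least \<open>\<kappa>\<close> does not increase its size, and saturating a
  smaller one keeps it below \<open>\<kappa>\<close>.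

  By induction on the size of the saturated set \<open>A\<close> there is a family of continuous functions that
  separates the points of the \<open>A\<close>-retract of \<open>L\<close>, fewer than \<open>\<kappa>\<close> of them nonzero at each point.
  If \<open>A\<close> has fewer than \<open>\<kappa>\<close> elements, Urysohn functions for pairs of boxes suffice. Otherwise
  \<open>A\<close> is the union of a continuous increasing chain of smaller saturated sets, and the family
  consists of the functions \<open>\<phi> - \<phi> \<circ> r\<close>, where \<open>\<phi>\<close> belongs to the family of a member of the chain
  and \<open>r\<close> is the retraction to its predecessor. A point \<open>x\<close> of \<open>K\<close> sees only those members that
  acquire a coordinate in its support.
\<close>

section \<open>Counting finite sets, restricting coordinates, and rational boxes\<close>

lemma card_of_Fpow_Times_countable:
  fixes A :: "'s set" and X :: "'x set"
  assumes X: "infinite X" and AX: "|A| \<le>o |X|"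
  shows "|Fpow (A \<times> (UNIV :: 'c::countable set))| \<le>o |X|"
proof (cases "finite (A \<times> (UNIV :: 'c set))")
  case True
  then have "finite (Fpow (A \<times> (UNIV :: 'c set)))"
    by (simp add: Fpow_Pow_finite)
  with X show ?thesis
    using finite_ordLess_infinite2 ordLess_imp_ordLeq by blast
next
  case False
  have "|UNIV :: 'c set| \<le>o |UNIV :: nat set|"
    by (meson card_of_ordLeq inj_to_nat subset_UNIV)
  also have "|UNIV :: nat set| \<le>o |X|"
    using X by (simp add: infinite_iff_card_of_nat)
  finally have "|A \<times> (UNIV :: 'c set)| \<le>o |X|"
    using X AX by (simp add: card_of_Sigma_ordLeq_infinite)
  then show ?thesis
    using card_of_Fpow_infinite[OF False] ordIso_ordLeq_trans by blast
qed

lemma real_eq_if_rat_bounds: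
  fixes u v :: real
  assumes "\<And>p q. of_rat p \<le> u \<Longrightarrow> u \<le> of_rat q \<Longrightarrow> of_rat p \<le> v \<and> v \<le> of_rat q"
  shows "u = v"
proof (rule ccontr)
  assume "u \<noteq> v"
  \<comment> \<open>The assumption speaks of two-sided intervals only; these bounds supply the side
    that the case distinction leaves open.\<close>
  obtain p q where pq: "of_rat p < u" "u < of_rat q"
    by (meson of_rat_dense gt_ex lt_ex)
  consider "u < v" | "v < u"
    using \<open>u \<noteq> v\<close> by linarith
  then show False
  proof cases
    case 1
    then obtain q' where "u < of_rat q'" "of_rat q' < v"
      using of_rat_dense by blast
    then show False using assms[of p q'] pq by auto
  next
    case 2
    then obtain p' where "v < of_rat p'" "of_rat p' < u"
      using of_rat_dense by blast
    then show False using assms[of p' q] pq by auto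
  qed
qed

text \<open>Coordinates outside \<open>A\<close> become 0 instead of \<open>undefined\<close>, so
  the result is again a function on the whole type, its support shrinks, and nested restrictions
  compose to the smaller one.\<close>

definition proj :: "'s set \<Rightarrow> ('s \<Rightarrow> real) \<Rightarrow> 's \<Rightarrow> real" where
  "proj A x = (\<lambda>s. if s \<in> A then x s else 0)"

lemma proj_proj: "C \<subseteq> A \<Longrightarrow> proj C (proj A x) = proj C x" "C \<subseteq> A \<Longrightarrow> proj A (proj C x) = proj C x"
  by (auto simp: proj_def fun_eq_iff)

lemma supp_proj: "supp UNIV (proj A x) \<subseteq> A"
  by (auto simp: supp_def proj_def)

lemma continuous_on_proj: "continuous_on X (proj A)"
proof -
  have "continuous_on X (\<lambda>x :: 'a \<Rightarrow> real. if s \<in> A then x s else 0)" for s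
    by (cases "s \<in> A") (auto intro: continuous_on_subset[OF continuous_on_product_coordinates subset_UNIV])
  then show ?thesis
    unfolding proj_def by (intro continuous_on_coordinatewise_then_product)
qed

text \<open>A finite set \<open>B\<close> codes a product of two closed boxes with rational sides: the Boolean tag
  tells which of the two factors is constrained.\<close>

type_synonym 's box = "('s \<times> bool \<times> rat \<times> rat) set"

definition side :: "bool \<Rightarrow> ('s \<Rightarrow> real) \<Rightarrow> 's box \<Rightarrow> bool" where
  "side b x B \<longleftrightarrow> (\<forall>(s, c, p, q) \<in> B. c = b \<longrightarrow> of_rat p \<le> x s \<and> x s \<le> of_rat q)"

definition in_box :: "('s \<Rightarrow> real) \<times> ('s \<Rightarrow> real) \<Rightarrow> 's box \<Rightarrow> bool" where
  "in_box z B \<longleftrightarrow> side True (fst z) B \<and> side False (snd z) B"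

lemma in_box_Union: "in_box z (\<Union>\<B>) \<longleftrightarrow> (\<forall>B\<in>\<B>. in_box z B)"
  by (auto simp: in_box_def side_def)

lemma closed_side: "closed {x. side b x B}"
proof -
  have "{x. side b x B} = (\<Inter>(s, c, p, q) \<in> B. {x. c = b \<longrightarrow> of_rat p \<le> x s \<and> x s \<le> of_rat q})"
    by (auto simp: side_def)
  moreover have "closed {x :: 'a \<Rightarrow> real. c = b \<longrightarrow> p \<le> x s \<and> x s \<le> q}" for c p q s
    by (intro closed_Collect_imp closed_Collect_conj closed_Collect_le open_Collect_const
        continuous_on_const continuous_on_product_coordinates)
  ultimately show ?thesis
    by (auto intro!: closed_INT)
qed

lemma closed_in_box: "closed {z. in_box z B}"
proof -
  have "{z. in_box z B} = {x. side True x B} \<times> {x. side False x B}"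
    by (auto simp: in_box_def)
  then show ?thesis
    by (simp add: closed_Times closed_side)
qed

lemma side_cong:
  assumes "fst ` B \<subseteq> A" "\<And>s. s \<in> A \<Longrightarrow> x s = y s"
  shows "side b x B \<longleftrightarrow> side b y B"
  unfolding side_def
proof (rule ball_cong)
  fix t assume t: "t \<in> B"
  obtain s c p q where st: "t = (s, c, p, q)" by (cases t)
  have "x s = y s"
    using assms t st by (metis fst_conv image_subset_iff)
  then show "(case t of (s, c, p, q) \<Rightarrow> c = b \<longrightarrow> of_rat p \<le> x s \<and> x s \<le> of_rat q) \<longleftrightarrow>
      (case t of (s, c, p, q) \<Rightarrow> c = b \<longrightarrow> of_rat p \<le> y s \<and> y s \<le> of_rat q)"
    by (simp add: st)
qed simp

lemma in_box_cong:
  assumes "fst ` B \<subseteq> A" "\<And>s. s \<in> A \<Longrightarrow> fst z s = fst w s" "\<And>s. s \<in> A \<Longrightarrow> snd z s = snd w s"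
  shows "in_box z B \<longleftrightarrow> in_box w B"
  using side_cong[OF assms(1,2)] side_cong[OF assms(1,3)] by (simp only: in_box_def)

lemma closed_supp_subset: "closed {x. supp UNIV x \<subseteq> A}"
proof -
  have "{x :: 'a \<Rightarrow> real. supp UNIV x \<subseteq> A} = (\<Inter>s\<in>-A. {x. x s = 0})"
    by (auto simp: supp_def)
  then show ?thesis
    by (auto intro!: closed_INT closed_Collect_eq continuous_on_product_coordinates)
qed

lemma chain_range_mono:
  fixes g :: "nat \<Rightarrow> 'x set"
  assumes "mono g"
  shows "subset.chain UNIV (range g)"
proof -
  have "g m \<subseteq> g n \<or> g n \<subseteq> g m" for m n
    using monoD[OF assms, of m n] monoD[OF assms, of n m] by linarith
  then show ?thesis
    by (simp add: subset_chain_def)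
qed

section \<open>The compact set \<open>K\<close>, the map \<open>f\<close>, and sets smaller than
  \<kappa>\<close>

locale corson_image =
  fixes \<kappa> :: "'k rel" and K :: "('s \<Rightarrow> real) set" and L :: "'b topology" and f :: "('s \<Rightarrow> real) \<Rightarrow> 'b"
  assumes card_order: "Card_order \<kappa>" and uncountable: "natLeq <o \<kappa>" and regular: "regularCard \<kappa>"
    and compact_K: "compact K" and small_supp: "\<And>x. x \<in> K \<Longrightarrow> |supp UNIV x| <o \<kappa>"
    and Hausdorff_L: "Hausdorff_space L"
    and continuous_f: "continuous_map (top_of_set K) L f" and f_image: "f ` K = topspace L"
begin

lemma Cinfinite_kappa: "Cinfinite \<kappa>"
  using cinfinite_mono[OF ordLess_imp_ordLeq[OF uncountable] natLeq_cinfinite] card_order by simp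

lemma small_finite: "finite A \<Longrightarrow> |A| <o \<kappa>"
  by (rule Cfinite_ordLess_Cinfinite[OF _ Cinfinite_kappa]) (simp add: cfinite_def)

lemma small_UN:
  assumes "|I| <o \<kappa>" and "\<And>i. i \<in> I \<Longrightarrow> |A i| <o \<kappa>"
  shows "|\<Union>i\<in>I. A i| <o \<kappa>"
  using regularCard_UNION_bound[OF Cinfinite_kappa regular] assms by blast

lemma small_nat: "|UNIV :: nat set| <o \<kappa>"
  using uncountable card_of_nat ordIso_ordLess_trans by blast

lemma small_Un: "|A| <o \<kappa> \<Longrightarrow> |B| <o \<kappa> \<Longrightarrow> |A \<union> B| <o \<kappa>"
  using Cinfinite_kappa by (simp add: card_of_Un_ordLess_infinite_Field cinfinite_def)

lemma small_image: "|A| <o \<kappa> \<Longrightarrow> |g ` A| <o \<kappa>"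
  using card_of_image ordLeq_ordLess_trans by blast

lemma small_subset: "|B| <o \<kappa> \<Longrightarrow> A \<subseteq> B \<Longrightarrow> |A| <o \<kappa>"
  using card_of_mono1 ordLeq_ordLess_trans by blast

text \<open>Bounds the number of boxes over \<open>A\<close>. Even a finite \<open>A\<close> can
  carry infinitely many boxes, so that case is measured against the natural numbers, where
  uncountability of \<kappa> enters.\<close>

lemma small_Fpow:
  fixes A :: "'x set"
  assumes "|A| <o \<kappa>"
  shows "|Fpow (A \<times> (UNIV :: 'c::countable set))| <o \<kappa>"
proof (cases "finite A")
  case True
  then have "|A| \<le>o |UNIV :: nat set|"
    by (simp add: finite_ordLess_infinite2 ordLess_imp_ordLeq)
  then show ?thesis
    using card_of_Fpow_Times_countable[of "UNIV :: nat set" A] small_nat ordLeq_ordLess_trans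
    by blast
next
  case False
  then show ?thesis
    using card_of_Fpow_Times_countable[of A A] assms ordLeq_ordLess_trans card_of_refl
      ordIso_imp_ordLeq by blast
qed

section \<open>The kernel relation of \<open>f\<close> and compactness\<close>

definition fibre_pairs :: "(('s \<Rightarrow> real) \<times> ('s \<Rightarrow> real)) set" where
  "fibre_pairs = {z \<in> K \<times> K. f (fst z) = f (snd z)}"

definition fibre_pairs_on :: "'s set \<Rightarrow> (('s \<Rightarrow> real) \<times> ('s \<Rightarrow> real)) set" where
  "fibre_pairs_on A = {z \<in> fibre_pairs. supp UNIV (fst z) \<subseteq> A \<and> supp UNIV (snd z) \<subseteq> A}"

lemma compact_fibre_pairs: "compact fibre_pairs"
proof -
  let ?X = "top_of_set (K \<times> K)"
  have "continuous_map ?X (top_of_set K) fst" "continuous_map ?X (top_of_set K) snd"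
    by (auto intro: continuous_on_fst continuous_on_snd continuous_on_id)
  then have "continuous_map ?X L (f \<circ> fst)" "continuous_map ?X L (f \<circ> snd)"
    using continuous_f continuous_map_compose by blast+
  from closedin_continuous_maps_eq[OF Hausdorff_L this]
  have "closedin ?X fibre_pairs"
    by (simp add: fibre_pairs_def)
  then show ?thesis
    by (rule closedin_compact[OF compact_Times[OF compact_K compact_K]])
qed

lemma compact_fibre_pairs_on: "compact (fibre_pairs_on A)"
proof -
  have "fibre_pairs_on A = fibre_pairs \<inter> ({x. supp UNIV x \<subseteq> A} \<times> {x. supp UNIV x \<subseteq> A})"
    by (auto simp: fibre_pairs_on_def)
  then show ?thesis
    by (simp add: compact_Int_closed compact_fibre_pairs closed_Times closed_supp_subset)
qed

text \<open>A union of codes describes the intersection of the boxes, so the hypothesis gives the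
  boxes around \<open>(x, y)\<close> over \<open>A\<close> the finite intersection property on the
  compact set \<open>fibre_pairs_on A\<close>. A pair lying in all of them agrees with
  \<open>(x, y)\<close> on \<open>A\<close> and vanishes elsewhere, so it is the projected
  pair.\<close>

lemma proj_in_fibre_pairs:
  assumes meets: "\<And>B. finite B \<Longrightarrow> fst ` B \<subseteq> A \<Longrightarrow> in_box (x, y) B \<Longrightarrow> \<exists>z \<in> fibre_pairs_on A. in_box z B"
  shows "(proj A x, proj A y) \<in> fibre_pairs"
proof -
  define \<B> where "\<B> = {B. finite B \<and> fst ` B \<subseteq> A \<and> in_box (x, y) B}"
  let ?F = "(\<lambda>B. {z. in_box z B}) ` \<B>"
  have "fibre_pairs_on A \<inter> \<Inter>?F \<noteq> {}"
  proof (rule compact_imp_fip[OF compact_fibre_pairs_on])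
    fix F' assume "finite F'" "F' \<subseteq> ?F"
    then obtain \<C> where \<C>: "\<C> \<subseteq> \<B>" "finite \<C>" "F' = (\<lambda>B. {z. in_box z B}) ` \<C>"
      by (meson finite_subset_image)
    have "finite (\<Union>\<C>)" "fst ` \<Union>\<C> \<subseteq> A" "in_box (x, y) (\<Union>\<C>)"
      using \<C> unfolding in_box_Union \<B>_def by blast+
    from meets[OF this] show "fibre_pairs_on A \<inter> \<Inter>F' \<noteq> {}"
      unfolding in_box_Union using \<C> by blast
  qed (auto simp: closed_in_box)
  then obtain z where z: "z \<in> fibre_pairs_on A" "\<And>B. B \<in> \<B> \<Longrightarrow> in_box z B"
    by blast
  have "x s = fst z s \<and> y s = snd z s" if s: "s \<in> A" for s
  proof
    show "x s = fst z s"
    proof (rule real_eq_if_rat_bounds)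
      fix p q assume "of_rat p \<le> x s" "x s \<le> of_rat q"
      then have "{(s, True, p, q)} \<in> \<B>"
        using s by (auto simp: \<B>_def in_box_def side_def)
      from z(2)[OF this] show "of_rat p \<le> fst z s \<and> fst z s \<le> of_rat q"
        by (auto simp: in_box_def side_def)
    qed
    show "y s = snd z s"
    proof (rule real_eq_if_rat_bounds)
      fix p q assume "of_rat p \<le> y s" "y s \<le> of_rat q"
      then have "{(s, False, p, q)} \<in> \<B>"
        using s by (auto simp: \<B>_def in_box_def side_def)
      from z(2)[OF this] show "of_rat p \<le> snd z s \<and> snd z s \<le> of_rat q"
        by (auto simp: in_box_def side_def)
    qed
  qed
  moreover have "supp UNIV (fst z) \<subseteq> A" "supp UNIV (snd z) \<subseteq> A"
    using z by (auto simp: fibre_pairs_on_def)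
  ultimately have "fst z = proj A x" "snd z = proj A y"
    by (auto simp: proj_def fun_eq_iff supp_def)
  then show ?thesis
    using z by (metis (no_types, lifting) fibre_pairs_on_def mem_Collect_eq prod.collapse)
qed

section \<open>Saturated sets of coordinates and the retractions they induce\<close>

definition pick :: "'s box \<Rightarrow> ('s \<Rightarrow> real) \<times> ('s \<Rightarrow> real)" where
  "pick B = (SOME z. z \<in> fibre_pairs \<and> in_box z B)"

text \<open>For a box that misses \<open>fibre_pairs\<close> the value of \<open>pick\<close> is
  arbitrary and its support uncontrolled, hence the default \<open>{}\<close>.\<close>

definition coords :: "'s box \<Rightarrow> 's set" where
  "coords B = (if \<exists>z\<in>fibre_pairs. in_box z B then supp UNIV (fst (pick B)) \<union> supp UNIV (snd (pick B)) else {})"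

text \<open>Since \<open>pick\<close> is fixed, this is closure under a single operator with finite
  arguments. Such sets are stable under intersections, which yields hulls, and under unions of
  nonempty chains.\<close>

definition saturated :: "'s set \<Rightarrow> bool" where
  "saturated A \<longleftrightarrow> (\<forall>B. finite B \<longrightarrow> fst ` B \<subseteq> A \<longrightarrow> coords B \<subseteq> A)"

lemma pick: "z \<in> fibre_pairs \<Longrightarrow> in_box z B \<Longrightarrow> pick B \<in> fibre_pairs \<and> in_box (pick B) B"
  unfolding pick_def by (rule someI) auto

lemma small_coords: "|coords B| <o \<kappa>"
proof (cases "\<exists>z\<in>fibre_pairs. in_box z B")
  case True
  then have "pick B \<in> fibre_pairs" using pick by blast
  then have "fst (pick B) \<in> K" "snd (pick B) \<in> K" by (auto simp: fibre_pairs_def)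
  then show ?thesis
    using True by (simp add: coords_def small_Un small_supp)
next
  case False
  then show ?thesis
    unfolding coords_def by (simp only: if_False small_finite finite.emptyI)
qed

text \<open>A box around \<open>(x, y)\<close> meets \<open>fibre_pairs\<close> in
  \<open>(x, y)\<close> itself, so \<open>pick\<close> returns a genuine pair in it, and saturation
  places the support of that pair inside \<open>A\<close>.\<close>

lemma fibre_pairs_proj:
  assumes "saturated A" "(x, y) \<in> fibre_pairs"
  shows "(proj A x, proj A y) \<in> fibre_pairs"
proof (rule proj_in_fibre_pairs)
  fix B :: "'s box" assume B: "finite B" "fst ` B \<subseteq> A" "in_box (x, y) B"
  then have "coords B \<subseteq> A" using assms by (simp add: saturated_def)
  then show "\<exists>z\<in>fibre_pairs_on A. in_box z B"
    using pick[OF assms(2) B(3)] assms(2) B(3)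
    by (intro bexI[of _ "pick B"]) (auto simp: fibre_pairs_on_def coords_def split: if_splits)
qed

lemma proj_in_K: "saturated A \<Longrightarrow> x \<in> K \<Longrightarrow> proj A x \<in> K"
  using fibre_pairs_proj[of A x x] by (simp add: fibre_pairs_def)

text \<open>This makes the retraction of \<open>L\<close> that sends \<open>f x\<close> to
  \<open>f (proj A x)\<close> well defined. The retraction never appears as a map on
  \<open>L\<close>; all later statements use \<open>f (proj A x)\<close> for \<open>x\<close> in
  \<open>K\<close>.\<close>

lemma f_proj_cong: "saturated A \<Longrightarrow> x \<in> K \<Longrightarrow> y \<in> K \<Longrightarrow> f x = f y \<Longrightarrow> f (proj A x) = f (proj A y)"
  using fibre_pairs_proj[of A x y] by (simp add: fibre_pairs_def)

text \<open>The retraction for \<open>C\<close> factors through the one for \<open>A\<close>,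
  because restricting to \<open>A\<close> and then to \<open>C\<close> is restricting to
  \<open>C\<close>.\<close>

lemma f_proj_mono:
  assumes "saturated A" "saturated C" "C \<subseteq> A" "x \<in> K" "y \<in> K" "f (proj A x) = f (proj A y)"
  shows "f (proj C x) = f (proj C y)"
  using f_proj_cong[OF assms(2) proj_in_K proj_in_K assms(6)] assms by (simp add: proj_proj)

lemma saturated_Inter: "Ball \<C> saturated \<Longrightarrow> saturated (\<Inter>\<C>)"
  unfolding saturated_def by blast

lemma saturated_hull [simp]: "saturated (saturated hull X)"
  by (simp add: hull_in saturated_Inter)

lemma finite_box_chain:
  assumes "subset.chain UNIV \<C>" "\<C> \<noteq> {}" "finite B" "fst ` B \<subseteq> \<Union>\<C>"
  obtains C where "C \<in> \<C>" "fst ` B \<subseteq> C"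
  using finite_subset_Union_chain[of "fst ` B" \<C> UNIV] assms by blast

lemma saturated_Union_chain:
  assumes "subset.chain UNIV \<C>" "\<C> \<noteq> {}" "Ball \<C> saturated"
  shows "saturated (\<Union>\<C>)"
  unfolding saturated_def
proof (intro allI impI)
  fix B :: "'s box" assume "finite B" "fst ` B \<subseteq> \<Union>\<C>"
  then obtain C where "C \<in> \<C>" "fst ` B \<subseteq> C" using assms finite_box_chain by blast
  then show "coords B \<subseteq> \<Union>\<C>"
    using assms \<open>finite B\<close> unfolding saturated_def by blast
qed

text \<open>The limit step of the later transfinite induction. A box over the union constrains
  finitely many coordinates, so it lies over one member \<open>C\<close>, and the pair projected to
  \<open>C\<close> is the required witness.\<close>

lemma f_proj_Union_chain:
  assumes \<C>: "subset.chain UNIV \<C>" "\<C> \<noteq> {}" "Ball \<C> saturated" and xy: "x \<in> K" "y \<in> K"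
    and eq: "\<And>C. C \<in> \<C> \<Longrightarrow> f (proj C x) = f (proj C y)"
  shows "f (proj (\<Union>\<C>) x) = f (proj (\<Union>\<C>) y)"
proof -
  have "(proj (\<Union>\<C>) x, proj (\<Union>\<C>) y) \<in> fibre_pairs"
  proof (rule proj_in_fibre_pairs)
    fix B :: "'s box" assume B: "finite B" "fst ` B \<subseteq> \<Union>\<C>" "in_box (x, y) B"
    then obtain C where C: "C \<in> \<C>" "fst ` B \<subseteq> C" using \<C> finite_box_chain by blast
    have "in_box (proj C x, proj C y) B"
      using in_box_cong[OF C(2), of "(proj C x, proj C y)" "(x, y)"] B(3) by (simp add: proj_def)
    moreover have "(proj C x, proj C y) \<in> fibre_pairs_on (\<Union>\<C>)"
      using \<C> C xy eq proj_in_K supp_proj[of C] by (force simp: fibre_pairs_on_def fibre_pairs_def)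
    ultimately show "\<exists>z\<in>fibre_pairs_on (\<Union>\<C>). in_box z B" by blast
  qed
  then show ?thesis by (simp add: fibre_pairs_def)
qed

section \<open>Cardinality of saturated hulls\<close>

definition step :: "'s set \<Rightarrow> 's set" where
  "step A = A \<union> (\<Union>B \<in> Fpow (A \<times> UNIV). coords B)"

text \<open>The stages increase, so the finitely many coordinates of a box all occur at some finite
  stage, and the next stage absorbs its \<open>coords\<close>. Hence their union is already
  saturated.\<close>

lemma hull_subset_step: "saturated hull X \<subseteq> (\<Union>n. (step ^^ n) X)"
proof (rule hull_minimal)
  show "X \<subseteq> (\<Union>n. (step ^^ n) X)"
    using UN_upper[of 0 UNIV "\<lambda>n. (step ^^ n) X"] by simp
  have "mono (\<lambda>n. (step ^^ n) X)"
    by (rule monoI, rule lift_Suc_mono_le) (auto simp: step_def)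
  then have chain: "subset.chain UNIV (range (\<lambda>n. (step ^^ n) X))"
    by (rule chain_range_mono)
  show "saturated (\<Union>n. (step ^^ n) X)"
    unfolding saturated_def
  proof (intro allI impI)
    fix B :: "'s box" assume B: "finite B" "fst ` B \<subseteq> (\<Union>n. (step ^^ n) X)"
    then obtain n where "fst ` B \<subseteq> (step ^^ n) X"
      using finite_box_chain[OF chain] by blast
    then have "B \<in> Fpow ((step ^^ n) X \<times> UNIV)"
      using B by (force simp: Fpow_def)
    then have "coords B \<subseteq> (step ^^ Suc n) X"
      by (auto simp: step_def)
    then show "coords B \<subseteq> (\<Union>n. (step ^^ n) X)" by blast
  qed
qed

text \<open>By regularity each stage stays below \<kappa>, being built from fewer than \<kappa>
  small sets; the union of the countably many stages stays small because \<kappa> is also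
  uncountable.\<close>

lemma card_hull_small:
  assumes "|X| <o \<kappa>"
  shows "|saturated hull X| <o \<kappa>"
proof -
  have "|(step ^^ n) X| <o \<kappa>" for n
  proof (induction n)
    case (Suc n)
    then show ?case
      by (simp add: step_def[of "(step ^^ n) X"] small_Un small_UN small_coords small_Fpow)
  qed (simp add: assms)
  then have "|\<Union>n. (step ^^ n) X| <o \<kappa>"
    by (simp add: small_UN small_nat)
  then show ?thesis using hull_subset_step small_subset by blast
qed

text \<open>The infinite cardinal of \<open>X\<close> bounds every \<open>coords B\<close>, the
  number of boxes over each stage, and the number of stages.\<close>

lemma card_hull_large:
  assumes "\<kappa> \<le>o |X|"
  shows "|saturated hull X| \<le>o |X|"
proof -
  have X: "infinite X"
    using small_finite[of X] assms not_ordLess_ordLeq by blast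
  have "|(step ^^ n) X| \<le>o |X|" for n
  proof (induction n)
    case (Suc n)
    have "|coords B| \<le>o |X|" for B
      using small_coords assms ordLess_ordLeq_trans ordLess_imp_ordLeq by blast
    then have "|\<Union>B \<in> Fpow ((step ^^ n) X \<times> UNIV). coords B| \<le>o |X|"
      using Suc X by (intro card_of_UNION_ordLeq_infinite card_of_Fpow_Times_countable) auto
    then show ?case
      using Suc X by (simp add: step_def[of "(step ^^ n) X"] card_of_Un_ordLeq_infinite)
  qed simp
  then have "|\<Union>n. (step ^^ n) X| \<le>o |X|"
    using X by (intro card_of_UNION_ordLeq_infinite) (auto simp: infinite_iff_card_of_nat)
  then show ?thesis
    by (rule ordLeq_transitive[OF card_of_mono1[OF hull_subset_step]])
qed

text \<open>Keeps the members of the transfinite chain below \<open>A\<close> strictly smaller than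
  \<open>A\<close>, whichever side of \<kappa> the generating set lies on.\<close>

lemma card_hull:
  assumes "|X| <o |A|" "\<kappa> \<le>o |A|"
  shows "|saturated hull X| <o |A|"
proof (cases "|X| <o \<kappa>")
  case True
  then show ?thesis using card_hull_small assms ordLess_ordLeq_trans by blast
next
  case False
  then have "\<kappa> \<le>o |X|"
    using card_order by (meson card_of_Well_order card_order_on_well_order_on ordLess_or_ordLeq)
  then show ?thesis using card_hull_large assms ordLeq_ordLess_trans by blast
qed

section \<open>Families on \<open>K\<close> that factor through the \<open>A\<close>-retract of
  \<open>L\<close> and separate its points\<close>

definition separating :: "'s set \<Rightarrow> (('s \<Rightarrow> real) \<Rightarrow> real) set \<Rightarrow> bool" where
  "separating A \<Phi> \<longleftrightarrow>
     (\<forall>\<phi>\<in>\<Phi>. continuous_on K \<phi>) \<and>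
     (\<forall>\<phi>\<in>\<Phi>. \<forall>x\<in>K. \<forall>y\<in>K. f (proj A x) = f (proj A y) \<longrightarrow> \<phi> x = \<phi> y) \<and>
     (\<forall>x\<in>K. \<forall>y\<in>K. f (proj A x) \<noteq> f (proj A y) \<longrightarrow> (\<exists>\<phi>\<in>\<Phi>. \<phi> x \<noteq> \<phi> y)) \<and>
     (\<forall>x\<in>K. |{\<phi>\<in>\<Phi>. \<phi> x \<noteq> 0}| <o \<kappa>)"

lemma separatingD:
  assumes "separating A \<Phi>"
  shows "\<phi> \<in> \<Phi> \<Longrightarrow> continuous_on K \<phi>"
    and "\<phi> \<in> \<Phi> \<Longrightarrow> x \<in> K \<Longrightarrow> y \<in> K \<Longrightarrow> f (proj A x) = f (proj A y) \<Longrightarrow> \<phi> x = \<phi> y"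
    and "x \<in> K \<Longrightarrow> y \<in> K \<Longrightarrow> f (proj A x) \<noteq> f (proj A y) \<Longrightarrow> \<exists>\<phi>\<in>\<Phi>. \<phi> x \<noteq> \<phi> y"
    and "x \<in> K \<Longrightarrow> |{\<phi>\<in>\<Phi>. \<phi> x \<noteq> 0}| <o \<kappa>"
  using assms unfolding separating_def by blast+

lemma separatingI:
  assumes "\<And>\<phi>. \<phi> \<in> \<Phi> \<Longrightarrow> continuous_on K \<phi>"
    and "\<And>\<phi> x y. \<phi> \<in> \<Phi> \<Longrightarrow> x \<in> K \<Longrightarrow> y \<in> K \<Longrightarrow> f (proj A x) = f (proj A y) \<Longrightarrow> \<phi> x = \<phi> y"
    and "\<And>x y. x \<in> K \<Longrightarrow> y \<in> K \<Longrightarrow> f (proj A x) \<noteq> f (proj A y) \<Longrightarrow> \<exists>\<phi>\<in>\<Phi>. \<phi> x \<noteq> \<phi> y"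
    and "\<And>x. x \<in> K \<Longrightarrow> |{\<phi>\<in>\<Phi>. \<phi> x \<noteq> 0}| <o \<kappa>"
  shows "separating A \<Phi>"
  unfolding separating_def
  by (intro conjI ballI impI; (rule assms; assumption))

lemma compact_L: "compact_space L"
proof -
  have "compactin (top_of_set K) K"
    using compact_K by (simp add: compactin_subtopology)
  then have "compactin L (f ` K)"
    using image_compactin continuous_f by blast
  then show ?thesis
    by (simp add: f_image compact_space_def)
qed

lemma normal_L: "normal_space L"
  using compact_Hausdorff_or_regular_imp_normal_space compact_L Hausdorff_L by blast

text \<open>If \<open>x\<close> and \<open>y\<close> have different images in the retract,
  \<open>proj_in_fibre_pairs\<close> yields a box around \<open>(x, y)\<close> over \<open>A\<close>
  that misses \<open>fibre_pairs_on A\<close>. Its two factors, cut down to supports in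
  \<open>A\<close>, then have disjoint closed images in \<open>L\<close>. One Urysohn function for
  each such box suffices, and there are fewer than \<kappa> boxes over \<open>A\<close>.\<close>

lemma separating_small:
  assumes A: "saturated A" "|A| <o \<kappa>"
  shows "\<exists>\<Phi>. separating A \<Phi>"
proof -
  define U where "U = (\<lambda>b B. f ` (K \<inter> ({x. supp UNIV x \<subseteq> A} \<inter> {x. side b x B})))"
  have closed_U: "closedin L (U b B)" for b B
  proof -
    let ?C = "K \<inter> ({x. supp UNIV x \<subseteq> A} \<inter> {x. side b x B})"
    have "compact ?C"
      by (intro compact_Int_closed compact_K closed_Int closed_supp_subset closed_side)
    then have "compactin (top_of_set K) ?C"
      by (simp add: compactin_subtopology)
    then show ?thesis
      unfolding U_def
      using image_compactin[OF _ continuous_f] compactin_imp_closedin[OF Hausdorff_L] by blast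
  qed
  \<comment> \<open>Disjointness of the two images says exactly that the box contains no pair of
    \<open>fibre_pairs_on A\<close>.\<close>
  define \<B> where "\<B> = {B \<in> Fpow (A \<times> UNIV). U True B \<inter> U False B = {}}"
  have "\<exists>g. continuous_map L euclideanreal g \<and> g ` U True B \<subseteq> {0} \<and> g ` U False B \<subseteq> {1}"
    if "B \<in> \<B>" for B
    using that normal_L closed_U unfolding normal_space_iff_Urysohn_alt \<B>_def
    by (simp add: disjnt_def)
  then obtain g where g: "\<And>B. B \<in> \<B> \<Longrightarrow> continuous_map L euclideanreal (g B)"
      "\<And>B. B \<in> \<B> \<Longrightarrow> g B ` U True B \<subseteq> {0}" "\<And>B. B \<in> \<B> \<Longrightarrow> g B ` U False B \<subseteq> {1}"
    by metis
  \<comment> \<open>Composing with \<open>proj A\<close> makes each function depend on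
    \<open>f (proj A x)\<close> alone.\<close>
  define \<Phi> where "\<Phi> = (\<lambda>B. g B \<circ> f \<circ> proj A) ` \<B>"
  have "continuous_on K \<phi>" if \<phi>: "\<phi> \<in> \<Phi>" for \<phi>
  proof -
    obtain B where B: "B \<in> \<B>" "\<phi> = g B \<circ> f \<circ> proj A" using \<phi> unfolding \<Phi>_def by blast
    have "continuous_map (top_of_set K) (top_of_set K) (proj A)"
      using A proj_in_K by (auto simp: continuous_on_proj)
    then have "continuous_map (top_of_set K) euclideanreal \<phi>"
      unfolding B(2) by (rule continuous_map_compose[OF _ continuous_map_compose[OF continuous_f g(1)[OF B(1)]]])
    then show ?thesis by simp
  qed
  moreover have "\<exists>\<phi>\<in>\<Phi>. \<phi> x \<noteq> \<phi> y" if xy: "x \<in> K" "y \<in> K" "f (proj A x) \<noteq> f (proj A y)" for x y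
  proof -
    have "(proj A x, proj A y) \<notin> fibre_pairs"
      using xy by (simp add: fibre_pairs_def)
    then obtain B where B: "finite B" "fst ` B \<subseteq> A" "in_box (x, y) B"
        "\<forall>z\<in>fibre_pairs_on A. \<not> in_box z B"
      using proj_in_fibre_pairs[of A x y] by blast
    have "B \<in> Fpow (A \<times> UNIV)"
      using B by (force simp: Fpow_def)
    moreover have "U True B \<inter> U False B = {}"
    proof (rule ccontr)
      assume "U True B \<inter> U False B \<noteq> {}"
      then obtain v w where vw: "v \<in> K" "w \<in> K" "supp UNIV v \<subseteq> A" "supp UNIV w \<subseteq> A"
          "side True v B" "side False w B" "f v = f w"
        unfolding U_def by auto
      then have "(v, w) \<in> fibre_pairs_on A" "in_box (v, w) B"
        by (simp_all add: fibre_pairs_on_def fibre_pairs_def in_box_def)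
      then show False using B(4) by blast
    qed
    ultimately have "B \<in> \<B>" by (simp add: \<B>_def)
    moreover have "in_box (proj A x, proj A y) B"
      using in_box_cong[OF B(2), of "(proj A x, proj A y)" "(x, y)"] B(3) by (simp add: proj_def)
    then have "f (proj A x) \<in> U True B" "f (proj A y) \<in> U False B"
      using xy proj_in_K[OF A(1)] supp_proj[of A] by (auto simp: U_def in_box_def)
    ultimately have "g B (f (proj A x)) = 0" "g B (f (proj A y)) = 1"
      using g(2,3) by blast+
    then show ?thesis
      using \<open>B \<in> \<B>\<close> unfolding \<Phi>_def by (intro bexI[of _ "g B \<circ> f \<circ> proj A"]) auto
  qed
  moreover have "|\<Phi>| <o \<kappa>"
    unfolding \<Phi>_def using A(2)
    by (intro small_image small_subset[OF small_Fpow]) (auto simp: \<B>_def)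
  then have "|{\<phi>\<in>\<Phi>. \<phi> x \<noteq> 0}| <o \<kappa>" for x
    by (rule small_subset) auto
  ultimately have "separating A \<Phi>"
    unfolding separating_def by (auto simp: \<Phi>_def)
  then show ?thesis by blast
qed

text \<open>Continuity of the chain of hulls: the union on the right is saturated, as a chain union,
  and contains \<open>X\<close>. The hull of the empty set is inserted to keep the chain nonempty
  when \<open>X\<close> is empty; that hull can itself be nonempty, since the empty box may
  contribute coordinates.\<close>

lemma hull_initial_segment:
  assumes "wo_rel r" "wo_rel.ofilter r X"
  defines "\<C> \<equiv> insert (saturated hull {}) ((\<lambda>i. saturated hull (under r i)) ` X)"
  shows "subset.chain UNIV \<C>" "Ball \<C> saturated" "saturated hull X = \<Union>\<C>"
proof -
  interpret wo: wo_rel r by fact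
  have X: "under r i \<subseteq> X" "i \<in> Field r" if "i \<in> X" for i
    using assms(2) that by (auto simp: ofilter_def)
  have "under r i \<subseteq> under r j \<or> under r j \<subseteq> under r i" if "i \<in> X" "j \<in> X" for i j
    using X(2) that wo.TOTALS under_incr[OF wo.TRANS] by blast
  then show chain: "subset.chain UNIV \<C>"
    unfolding subset_chain_def \<C>_def by (auto simp: hull_mono) (meson hull_mono subsetD)
  show sat: "Ball \<C> saturated"
    by (auto simp: \<C>_def)
  have "i \<in> under r i" if "i \<in> X" for i
    using X(2)[OF that] wo.REFL by (auto simp: under_def refl_on_def)
  then have "X \<subseteq> \<Union>\<C>"
    unfolding \<C>_def using hull_subset[of _ saturated] by blast
  moreover have "saturated (\<Union>\<C>)"
    by (rule saturated_Union_chain[OF chain _ sat]) (simp add: \<C>_def)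
  moreover have "\<Union>\<C> \<subseteq> saturated hull X"
  proof (rule Sup_least)
    fix C assume "C \<in> \<C>"
    then consider "C = saturated hull {}" | i where "i \<in> X" "C = saturated hull (under r i)"
      by (auto simp: \<C>_def)
    then show "C \<subseteq> saturated hull X"
      by cases (simp_all add: hull_mono X(1))
  qed
  ultimately show "saturated hull X = \<Union>\<C>"
    by (intro equalityI hull_minimal)
qed

text \<open>In the cardinal well-order of \<open>A\<close> every proper initial segment is smaller
  than \<open>A\<close>, and by \<open>card_hull\<close> so is its hull. Thus \<open>IH\<close>
  applies to each \<open>H i\<close>, generated by the coordinates up to and including
  \<open>i\<close>; its predecessor \<open>H' i\<close> stops just before \<open>i\<close>.\<close>

lemma separating_large:
  assumes A: "saturated A" "\<kappa> \<le>o |A|"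
    and IH: "\<And>C. saturated C \<Longrightarrow> |C| <o |A| \<Longrightarrow> \<exists>\<Phi>. separating C \<Phi>"
  shows "\<exists>\<Phi>. separating A \<Phi>"
proof -
  let ?r = "|A|"
  interpret wo: wo_rel ?r by (simp add: wo_rel_def)
  have infA: "infinite A"
    using small_finite[of A] A(2) not_ordLess_ordLeq by blast
  define H where "H = (\<lambda>i. saturated hull (under ?r i))"
  define H' where "H' = (\<lambda>i. saturated hull (underS ?r i))"
  have sat: "saturated (H i)" "saturated (H' i)" "H' i \<subseteq> H i" for i
    by (simp_all add: H_def H'_def underS_subset_under hull_mono)
  have HA: "H i \<subseteq> A" for i
    using A(1) under_Field[of ?r i] by (simp add: H_def hull_minimal Field_card_of)
  \<comment> \<open>This makes the layers \<open>H i - H' i\<close> pairwise disjoint, which later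
    bounds how many of them a support can meet.\<close>
  have H_H': "H j \<subseteq> H' i" if "j \<in> underS ?r i" for i j
    unfolding H_def H'_def
  proof (intro hull_mono subsetI)
    fix k assume "k \<in> under ?r j"
    then have "(k, j) \<in> ?r" "(j, i) \<in> ?r" "j \<noteq> i"
      using that by (auto simp: under_def underS_def)
    then show "k \<in> underS ?r i"
      using transD[OF wo.TRANS] antisymD[OF wo.ANTISYM] by (auto simp: underS_def)
  qed
  have small_H: "|H i| <o |A|" if "i \<in> A" for i
  proof -
    have "|underS ?r i| <o |A|"
      using that by (simp add: card_of_underS Field_card_of)
    moreover have "|{i}| <o |A|"
      using infA by (simp add: finite_ordLess_infinite2)
    ultimately have "|underS ?r i \<union> {i}| <o |A|"
      by (rule card_of_Un_ordLess_infinite[OF infA])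
    moreover have "under ?r i = underS ?r i \<union> {i}"
      using that wo.REFL Refl_under_underS[of ?r i] by (simp add: Field_card_of)
    ultimately have "|under ?r i| <o |A|"
      by (simp only:)
    then show ?thesis
      unfolding H_def using A(2) by (rule card_hull)
  qed
  have "|{} :: 's set| <o |A|"
    using infA by (simp add: finite_ordLess_infinite2)
  then have small_hull_empty: "|saturated hull {}| <o |A|"
    using A(2) by (rule card_hull)
  \<comment> \<open>The chain starts at the hull of the empty set, which has no predecessor; its
    family therefore enters \<open>\<Phi>\<close> without taking differences.\<close>
  obtain \<Psi> where \<Psi>: "separating (saturated hull {}) \<Psi>"
    using IH[OF saturated_hull small_hull_empty] by blast
  obtain \<Theta> where \<Theta>: "\<And>i. i \<in> A \<Longrightarrow> separating (H i) (\<Theta> i)"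
    using IH[OF sat(1) small_H] by metis
  \<comment> \<open>Subtracting the value after retraction to \<open>H' i\<close> leaves only what
    the layer \<open>H i - H' i\<close> adds.\<close>
  define D where "D = (\<lambda>i \<phi> x. \<phi> x - \<phi> (proj (H' i) x) :: real)"
  define \<Phi> where "\<Phi> = \<Psi> \<union> (\<Union>i\<in>A. D i ` \<Theta> i)"

  have D_eq: "D i \<phi> x = D i \<phi> y"
    if "i \<in> A" "\<phi> \<in> \<Theta> i" "x \<in> K" "y \<in> K" "f (proj (H i) x) = f (proj (H i) y)" for i \<phi> x y
  proof -
    have "f (proj (H' i) x) = f (proj (H' i) y)"
      using f_proj_mono[OF sat that(3-5)] .
    then have "\<phi> (proj (H' i) x) = \<phi> (proj (H' i) y)"
      using separatingD(2)[OF \<Theta>[OF that(1)] that(2) proj_in_K proj_in_K] sat that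
      by (simp add: proj_proj)
    then show ?thesis
      using separatingD(2)[OF \<Theta>[OF that(1)] that(2-5)] by (simp add: D_def)
  qed

  have "continuous_on K \<phi>" if "\<phi> \<in> \<Phi>" for \<phi>
  proof -
    have "continuous_on K (D i \<phi>)" if "i \<in> A" "\<phi> \<in> \<Theta> i" for i \<phi>
    proof -
      have \<phi>: "continuous_on K \<phi>" using separatingD(1) \<Theta> that by blast
      have "continuous_on K (\<lambda>x. \<phi> (proj (H' i) x))"
        by (rule continuous_on_compose2[OF \<phi> continuous_on_proj]) (auto intro: proj_in_K sat)
      then show ?thesis using \<phi> unfolding D_def by (intro continuous_on_diff)
    qed
    then show ?thesis
      using that separatingD(1)[OF \<Psi>] by (auto simp: \<Phi>_def)
  qed
  moreover have "\<phi> x = \<phi> y"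
    if \<phi>: "\<phi> \<in> \<Phi>" and xy: "x \<in> K" "y \<in> K" "f (proj A x) = f (proj A y)" for \<phi> x y
  proof -
    have below: "f (proj C x) = f (proj C y)" if "saturated C" "C \<subseteq> A" for C
      using f_proj_mono[OF A(1) that xy] .
    have "saturated hull {} \<subseteq> A"
      using A(1) by (simp add: hull_minimal)
    note eq0 = below[OF saturated_hull this]
    from \<phi> consider "\<phi> \<in> \<Psi>" | i \<psi> where "i \<in> A" "\<psi> \<in> \<Theta> i" "\<phi> = D i \<psi>"
      unfolding \<Phi>_def by blast
    then show ?thesis
    proof cases
      case 1
      then show ?thesis using separatingD(2)[OF \<Psi> _ xy(1,2) eq0] by blast
    next
      case 2
      show ?thesis
        unfolding 2(3) by (rule D_eq[OF 2(1,2) xy(1,2) below[OF sat(1) HA]])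
    qed
  qed
  moreover have "\<exists>\<phi>\<in>\<Phi>. \<phi> x \<noteq> \<phi> y"
    if xy: "x \<in> K" "y \<in> K" "f (proj A x) \<noteq> f (proj A y)" for x y
  proof (rule ccontr)
    assume "\<not> ?thesis"
    \<comment> \<open>Agreement of \<open>x\<close> and \<open>y\<close> climbs the chain:
      \<open>\<Psi>\<close> gives the start, continuity of the chain passes to \<open>H' i\<close>,
      and the functions \<open>D i \<phi>\<close> pass from \<open>H' i\<close> to
      \<open>H i\<close>. The union of the chain is \<open>A\<close>, a contradiction.\<close>
    then have eq: "\<phi> x = \<phi> y" if "\<phi> \<in> \<Phi>" for \<phi> using that by blast
    have eq0: "f (proj (saturated hull {}) x) = f (proj (saturated hull {}) y)"
      using separatingD(3)[OF \<Psi> xy(1,2)] eq by (auto simp: \<Phi>_def)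
    have limit: "f (proj (saturated hull X) x) = f (proj (saturated hull X) y)"
      if X: "wo.ofilter X" and eqX: "\<And>j. j \<in> X \<Longrightarrow> f (proj (H j) x) = f (proj (H j) y)" for X
    proof -
      have "wo_rel ?r" by unfold_locales
      note seg = hull_initial_segment[OF this X]
      show ?thesis
        unfolding seg(3)
        by (rule f_proj_Union_chain[OF seg(1) _ seg(2) xy(1,2)])
          (use eq0 eqX in \<open>auto simp: H_def\<close>)
    qed
    have "f (proj (H i) x) = f (proj (H i) y)" if "i \<in> A" for i
      using that
    proof (induction i rule: wo.well_order_induct)
      case (1 i)
      have "wo.ofilter (underS ?r i)" by (rule wo.underS_ofilter)
      moreover have "f (proj (H j) x) = f (proj (H j) y)" if "j \<in> underS ?r i" for j
      proof -
        have "j \<noteq> i" "(j, i) \<in> ?r" using that by (auto simp: underS_def)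
        moreover from this have "j \<in> A" using FieldI1 by (metis Field_card_of)
        ultimately show ?thesis using 1(1) by blast
      qed
      ultimately have H': "f (proj (H' i) x) = f (proj (H' i) y)"
        unfolding H'_def by (rule limit)
      show ?case
      proof (rule ccontr)
        assume "f (proj (H i) x) \<noteq> f (proj (H i) y)"
        then obtain \<phi> where \<phi>: "\<phi> \<in> \<Theta> i" "\<phi> x \<noteq> \<phi> y"
          using separatingD(3)[OF \<Theta>[OF 1(2)] xy(1,2)] by blast
        have "\<phi> (proj (H' i) x) = \<phi> (proj (H' i) y)"
          using separatingD(2)[OF \<Theta>[OF 1(2)] \<phi>(1) proj_in_K proj_in_K] sat xy H'
          by (simp add: proj_proj)
        moreover have "D i \<phi> x = D i \<phi> y"
          using eq 1(2) \<phi>(1) by (auto simp: \<Phi>_def)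
        ultimately show False using \<phi>(2) by (simp add: D_def)
      qed
    qed
    moreover have "wo.ofilter A"
      using wo.Field_ofilter by (simp add: Field_card_of)
    ultimately have "f (proj (saturated hull A) x) = f (proj (saturated hull A) y)"
      by (intro limit)
    then show False using xy A(1) by (simp add: hull_same)
  qed
  moreover have "|{\<phi>\<in>\<Phi>. \<phi> x \<noteq> 0}| <o \<kappa>" if x: "x \<in> K" for x
  proof -
    \<comment> \<open>Only these layers matter at \<open>x\<close>. Choosing one support coordinate
      in each layer embeds \<open>I\<close> into the support of \<open>x\<close>, so
      \<open>I\<close> is small.\<close>
    define I where "I = {i \<in> A. supp UNIV x \<inter> (H i - H' i) \<noteq> {}}"
    \<comment> \<open>A difference that is nonzero at \<open>x\<close> has a nonzero term, so \<phi>
      is nonzero at \<open>x\<close> or at its projection to \<open>H' i\<close>. Both points lie in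
      \<open>K\<close>, so few \<phi> qualify.\<close>
    define N where "N = (\<lambda>i. D i ` ({\<phi>\<in>\<Theta> i. \<phi> x \<noteq> 0} \<union> {\<phi>\<in>\<Theta> i. \<phi> (proj (H' i) x) \<noteq> 0}))"
    define c where "c = (\<lambda>i. SOME s. s \<in> supp UNIV x \<inter> (H i - H' i))"
    have c: "c i \<in> supp UNIV x \<inter> (H i - H' i)" if "i \<in> I" for i
      using that unfolding c_def some_in_eq I_def by blast
    have "inj_on c I"
    proof (rule inj_onI, rule ccontr)
      fix i j assume ij: "i \<in> I" "j \<in> I" "c i = c j" "i \<noteq> j"
      then have "i \<in> underS ?r j \<or> j \<in> underS ?r i"
        using wo.TOTALS by (auto simp: underS_def I_def Field_card_of)
      then show False
        using H_H' c[OF ij(1)] c[OF ij(2)] ij(3) by auto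
    qed
    then have "|I| \<le>o |supp UNIV x|"
      using c by (intro card_of_ordLeqI) auto
    then have "|I| <o \<kappa>"
      using small_supp[OF x] ordLeq_ordLess_trans by blast
    moreover have "|N i| <o \<kappa>" if "i \<in> I" for i
    proof -
      have "separating (H i) (\<Theta> i)" using that \<Theta> by (simp add: I_def)
      then show ?thesis
        unfolding N_def using x sat
        by (intro small_image small_Un separatingD(4) proj_in_K)
    qed
    ultimately have "|{\<phi>\<in>\<Psi>. \<phi> x \<noteq> 0} \<union> (\<Union>i\<in>I. N i)| <o \<kappa>"
      by (intro small_Un small_UN separatingD(4)[OF \<Psi> x])
    moreover have "{\<phi>\<in>\<Phi>. \<phi> x \<noteq> 0} \<subseteq> {\<phi>\<in>\<Psi>. \<phi> x \<noteq> 0} \<union> (\<Union>i\<in>I. N i)"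
    proof -
      have "i \<in> I \<and> D i \<phi> \<in> N i" if i: "i \<in> A" "\<phi> \<in> \<Theta> i" "D i \<phi> x \<noteq> 0" for i \<phi>
      proof
        show "i \<in> I"
        proof (rule ccontr)
          assume "i \<notin> I"
          \<comment> \<open>Without support in the layer, \<open>x\<close> and its projection to
            \<open>H' i\<close> have the same restriction to \<open>H i\<close>; hence \<phi> takes
            equal values there and the difference vanishes.\<close>
          then have "proj (H i) x = proj (H' i) x"
            using i(1) sat(3)[of i] by (auto simp: I_def proj_def supp_def fun_eq_iff)
          then have "f (proj (H i) x) = f (proj (H i) (proj (H' i) x))"
            by (simp add: proj_proj sat)
          from separatingD(2)[OF \<Theta>[OF i(1)] i(2) x proj_in_K[OF sat(2) x] this]
          show False using i(3) by (simp add: D_def)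
        qed
        show "D i \<phi> \<in> N i"
          using i unfolding N_def D_def by (intro imageI) auto
      qed
      then show ?thesis
        unfolding \<Phi>_def by blast
    qed
    ultimately show ?thesis by (rule small_subset)
  qed
  ultimately have "separating A \<Phi>"
    by (rule separatingI)
  then show ?thesis by blast
qed

lemma separating_exists:
  assumes "saturated A"
  shows "\<exists>\<Phi>. separating A \<Phi>"
proof -
  have "wf (inv_image ordLess (\<lambda>A :: 's set. |A| ))"
    by (intro wf_inv_image wf_ordLess)
  then show ?thesis
    using assms
  proof (induction A rule: wf_induct_rule)
    case (less A)
    show ?case
    proof (cases "|A| <o \<kappa>")
      case True
      then show ?thesis using separating_small less.prems by blast
    next
      case False
      then have "\<kappa> \<le>o |A|"
        using card_order by (meson card_of_Well_order card_order_on_well_order_on ordLess_or_ordLeq)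
      show ?thesis
      proof (rule separating_large[OF less.prems \<open>\<kappa> \<le>o |A|\<close>])
        fix C assume "saturated C" "|C| <o |A|"
        then show "\<exists>\<Phi>. separating C \<Phi>"
          using less.IH[of C] by (simp add: inv_image_def)
      qed
    qed
  qed
qed

section \<open>From a separating family for all coordinates to an embedding of
  \<open>L\<close>\<close>

theorem kappa_Corson_image: "kappa_Corson \<kappa> L"
proof -
  have "saturated UNIV" by (simp add: saturated_def)
  then obtain \<Phi> where \<Phi>: "separating UNIV \<Phi>"
    using separating_exists by blast
  have proj_UNIV: "proj UNIV x = x" for x :: "'s \<Rightarrow> real"
    by (simp add: proj_def)
  define T where "T = \<Phi> \<times> (UNIV :: bool set)"
  \<comment> \<open>An arbitrary section of \<open>f\<close>, in general discontinuous. Still, each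
    \<phi> is constant on the fibres of \<open>f\<close>, and \<open>f\<close> is a quotient map, so
    \<phi> after \<open>h\<close> is continuous on \<open>L\<close>.\<close>
  define h where "h = inv_into K f"
  have h: "h y \<in> K" "f (h y) = y" if "y \<in> topspace L" for y
    using that f_image by (auto simp: h_def inv_into_into f_inv_into_f)
  have \<Phi>_h: "\<phi> (h (f x)) = \<phi> x" if "\<phi> \<in> \<Phi>" "x \<in> K" for \<phi> x
  proof -
    have "f x \<in> topspace L" using that f_image by blast
    then show ?thesis
      using separatingD(2)[OF \<Phi> that(1) h(1) that(2)] h(2) by (simp add: proj_UNIV)
  qed
  have quot: "quotient_map (top_of_set K) L f"
  proof (rule continuous_closed_imp_quotient_map)
    show "closed_map (top_of_set K) L f"
      using compact_K continuous_f Hausdorff_L continuous_imp_closed_map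
      by (metis compact_space_subtopology compactin_euclidean_iff)
  qed (use continuous_f f_image in auto)
  have cont: "continuous_map L euclideanreal (\<lambda>y. \<phi> (h y))" if "\<phi> \<in> \<Phi>" for \<phi>
  proof -
    have "continuous_map (top_of_set K) euclideanreal ((\<lambda>y. \<phi> (h y)) \<circ> f)"
    proof (rule continuous_map_eq)
      show "continuous_map (top_of_set K) euclideanreal \<phi>"
        using separatingD(1)[OF \<Phi> that] by simp
    qed (use \<Phi>_h[OF that] in auto)
    then show ?thesis
      by (rule continuous_compose_quotient_map[OF quot])
  qed
  \<comment> \<open>Turns a real value into two coordinates in [0,1], its positive and negative
    parts compressed by \<open>arctan\<close>; halving suffices since \<open>pi\<close> is below 4.
    Zero goes to zero, which keeps supports small, and the two parts together determine the
    value.\<close>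
  define sgn_part where "sgn_part = (\<lambda>b t. max 0 (arctan (if b then t else - t)) / 2)"
  have sgn_part_01: "sgn_part b t \<in> {0..1}" for b t
    using arctan_bounded[of "if b then t else - t"] pi_less_4 by (auto simp: sgn_part_def max_def)
  have sgn_part_inj: "t = u" if "\<And>b. sgn_part b t = sgn_part b u" for t u
  proof -
    have "arctan t = arctan u"
      using that[of True] that[of False] by (auto simp: sgn_part_def max_def arctan_minus split: if_splits)
    then show ?thesis by (simp add: arctan_eq_iff)
  qed
  have sgn_part_0: "sgn_part b 0 = 0" for b
    by (simp add: sgn_part_def)
  have sgn_part_cont: "continuous_map L (top_of_set {0..1}) (\<lambda>y. sgn_part b (\<phi> (h y)))"
    if "\<phi> \<in> \<Phi>" for \<phi> b
  proof -
    have "continuous_map L euclideanreal (sgn_part b \<circ> (\<lambda>y. \<phi> (h y)))"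
      using cont[OF that]
    proof (rule continuous_map_compose)
      show "continuous_map euclideanreal euclideanreal (sgn_part b)"
        by (cases b) (auto simp: sgn_part_def intro!: continuous_intros)
    qed
    then show ?thesis
      using sgn_part_01 by (auto simp: continuous_map_in_subtopology o_def)
  qed
  define e where "e = (\<lambda>y. restrict (\<lambda>(\<phi>, b). sgn_part b (\<phi> (h y))) T)"
  have "continuous_map L (product_topology (\<lambda>_. top_of_set {0..1}) T) e"
    using sgn_part_cont unfolding continuous_map_componentwise
    by (auto simp: e_def T_def)
  moreover have "|supp T (e y)| <o \<kappa>" if "y \<in> topspace L" for y
  proof -
    have "\<phi> (h y) \<noteq> 0" if "sgn_part b (\<phi> (h y)) \<noteq> 0" for \<phi> b
      using that sgn_part_0 by metis
    then have "supp T (e y) \<subseteq> (\<Union>b. (\<lambda>\<phi>. (\<phi>, b)) ` {\<phi>\<in>\<Phi>. \<phi> (h y) \<noteq> 0})"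
      by (auto simp: supp_def e_def T_def)
    moreover have "|\<Union>b :: bool. (\<lambda>\<phi>. (\<phi>, b)) ` {\<phi>\<in>\<Phi>. \<phi> (h y) \<noteq> 0}| <o \<kappa>"
      using h(1)[OF that]
      by (intro small_UN small_image separatingD(4)[OF \<Phi>] small_finite) auto
    ultimately show ?thesis using small_subset by blast
  qed
  ultimately have "continuous_map L (Sigma_space \<kappa> T) e"
    by (auto simp: Sigma_space_def continuous_map_in_subtopology)
  moreover have "Hausdorff_space (Sigma_space \<kappa> T)"
    by (simp add: Sigma_space_def Hausdorff_space_subtopology Hausdorff_space_product_topology)
  moreover have "inj_on e (topspace L)"
  proof (rule inj_onI)
    fix y z assume yz: "y \<in> topspace L" "z \<in> topspace L" "e y = e z"
    have "\<phi> (h y) = \<phi> (h z)" if "\<phi> \<in> \<Phi>" for \<phi>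
    proof (rule sgn_part_inj)
      show "sgn_part b (\<phi> (h y)) = sgn_part b (\<phi> (h z))" for b
        using fun_cong[OF yz(3), of "(\<phi>, b)"] that by (simp add: e_def T_def)
    qed
    then have "f (proj UNIV (h y)) = f (proj UNIV (h z))"
      using separatingD(3)[OF \<Phi> h(1)[OF yz(1)] h(1)[OF yz(2)]] by blast
    then show "y = z"
      using yz h(2) by (simp add: proj_UNIV)
  qed
  ultimately have "embedding_map L (Sigma_space \<kappa> T) e"
    using compact_L by (simp add: continuous_imp_closed_map injective_closed_imp_embedding_map)
  then show ?thesis
    using kappa_CorsonI compact_L Hausdorff_L by blast
qed

end

section \<open>Replacing an abstract compact space by a compact set of functions on a whole
  type\<close>

theorem corollary2p17:
  fixes \<kappa> :: "'k rel" and K :: "'a topology" and L :: "'b topology" and f :: "'a \<Rightarrow> 'b"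
  assumes "Card_order \<kappa>" and "natLeq <o \<kappa>" and "regularCard \<kappa>"
    and "kappa_Corson \<kappa> K"
    and "compact_space L" and "Hausdorff_space L"
    and "continuous_map K L f" and "f ` topspace K = topspace L"
  shows "kappa_Corson \<kappa> L"
proof -
  obtain S :: "('a \<Rightarrow> real) set" and e where K: "compact_space K" and e: "embedding_map K (Sigma_space \<kappa> S) e"
    using assms(4) by (auto simp: kappa_Corson_def)
  have "continuous_map K (Sigma_space \<kappa> S) e"
    using e unfolding embedding_map_def
    by (meson continuous_map_in_subtopology homeomorphic_imp_continuous_map)
  then have e_cont: "continuous_map K (product_topology (\<lambda>_. top_of_set {0..1::real}) S) e"
    and e_supp: "\<And>x. x \<in> topspace K \<Longrightarrow> |supp S (e x)| <o \<kappa>"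
    by (auto simp: Sigma_space_def continuous_map_in_subtopology)
  have e_inj: "inj_on e (topspace K)"
    using e by (simp add: embedding_map_def homeomorphic_map_def)
  \<comment> \<open>Points of \<open>Sigma_space\<close> are \<open>undefined\<close> off
    \<open>S\<close>. Replacing that value by 0 makes the support over the whole type equal to the
    support over \<open>S\<close>, as \<open>corson_image\<close> requires.\<close>
  define g where "g = proj S \<circ> e"
  define K' where "K' = g ` topspace K"
  \<comment> \<open>The map \<open>f\<close> transported along the injection \<open>g\<close>; it is
    continuous because \<open>g\<close> is a quotient map onto \<open>K'\<close>.\<close>
  define f' where "f' = f \<circ> inv_into (topspace K) g"
  have g_inj: "inj_on g (topspace K)"
  proof (rule inj_onI)
    fix x y assume xy: "x \<in> topspace K" "y \<in> topspace K" "g x = g y"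
    have "e x \<in> extensional S" "e y \<in> extensional S"
      using e_cont xy by (auto simp: continuous_map_componentwise)
    moreover have "e x s = e y s" if "s \<in> S" for s
      using fun_cong[OF xy(3), of s] that by (simp add: g_def proj_def)
    ultimately have "e x = e y" by (meson extensionalityI)
    then show "x = y" using e_inj xy by (simp add: inj_on_def)
  qed
  have g_cont: "continuous_map K euclidean g"
  proof -
    have "continuous_map K euclideanreal (\<lambda>x. g x s)" for s
    proof (cases "s \<in> S")
      case True
      then have "continuous_map K (top_of_set {0..1::real}) (\<lambda>x. e x s)"
        using e_cont by (simp add: continuous_map_componentwise)
      then show ?thesis
        using True by (simp add: g_def proj_def continuous_map_in_subtopology)
    qed (simp add: g_def proj_def)
    then show ?thesis
      by (simp flip: euclidean_product_topology add: continuous_map_componentwise_UNIV)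
  qed
  have "compact K'"
    using image_compactin[OF _ g_cont] K by (auto simp: K'_def compact_space_def compactin_euclidean_iff)
  have quot: "quotient_map K (top_of_set K') g"
  proof (rule continuous_closed_imp_quotient_map)
    show cont: "continuous_map K (top_of_set K') g"
      using g_cont by (auto simp: K'_def continuous_map_in_subtopology)
    have "Hausdorff_space (euclidean :: (('a \<Rightarrow> real) \<Rightarrow> real) topology)"
      by (simp flip: euclidean_product_topology add: Hausdorff_space_product_topology)
    then show "closed_map K (top_of_set K') g"
      using K cont continuous_imp_closed_map Hausdorff_space_subtopology by blast
  qed (simp add: K'_def)
  have f'_g: "f' (g x) = f x" if "x \<in> topspace K" for x
    using that g_inj by (simp add: f'_def)
  have f'_cont: "continuous_map (top_of_set K') L f'"
  proof (rule continuous_compose_quotient_map[OF quot])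
    show "continuous_map K L (f' \<circ> g)"
      using assms(7) by (rule continuous_map_eq) (simp add: f'_g)
  qed
  interpret corson_image \<kappa> K' L f'
  proof
    show "|supp UNIV x| <o \<kappa>" if x: "x \<in> K'" for x
    proof -
      obtain y where y: "y \<in> topspace K" "x = g y" using x by (auto simp: K'_def)
      have "supp UNIV x = supp S (e y)"
        by (auto simp: y g_def proj_def supp_def)
      then show ?thesis using e_supp y by simp
    qed
    show "f' ` K' = topspace L"
      using f'_g assms(8) by (force simp: K'_def image_image)
  qed (use assms f'_cont \<open>compact K'\<close> in auto)
  show ?thesis by (rule kappa_Corson_image)
qed

end
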